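(* Let $d$ be an even positive integer and let $f$ be a form of degree $d$ in $n$ variables with real coefficients. Then the $d$-th root $f^{1/d}$ is a norm on $\mathbb{R}^n$ if and only if $f$ is strictly convex, i.e., $f(\lambda x+(1-\lambda)y)<\lambda f(x)+(1-\lambda)f(y)$ for all $x\neq y$ in $\mathbb{R}^n$ and all $\lambda\in(0,1)$.
   Context: A form is a homogeneous polynomial. The statement "$f^{1/d}$ is a norm" includes that $f$ is nonnegative, so that the real $d$-th root is well defined. *)

theory Defs
  imports "HOL-Analysis.Analysis" "HOL-Library.Poly_Mapping"
begin

(* Real polynomials in the variables x_i, i :: 'n, are finitely supported maps from
   exponent vectors to coefficients; the number of variables is CARD('n). *)
type_synonym 'n mpoly_real = "('n \<Rightarrow>\<^sub>0 nat) \<Rightarrow>\<^sub>0 real"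

definition monomial_degree :: "('n::finite \<Rightarrow>\<^sub>0 nat) \<Rightarrow> nat" where
  "monomial_degree m = (\<Sum>i\<in>UNIV. Poly_Mapping.lookup m i)"

(* As usual, the zero polynomial counts as a form of every degree. *)
definition is_form :: "nat \<Rightarrow> 'n::finite mpoly_real \<Rightarrow> bool" where
  "is_form d p \<longleftrightarrow> (\<forall>m\<in>Poly_Mapping.keys p. monomial_degree m = d)"

definition eval_mpoly :: "'n::finite mpoly_real \<Rightarrow> real ^ 'n \<Rightarrow> real" where
  "eval_mpoly p x = (\<Sum>m\<in>Poly_Mapping.keys p. Poly_Mapping.lookup p m * (\<Prod>i\<in>UNIV. (x $ i) ^ Poly_Mapping.lookup m i))"

definition is_norm :: "('a::real_vector \<Rightarrow> real) \<Rightarrow> bool" where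
  "is_norm N \<longleftrightarrow>
     (\<forall>x. 0 \<le> N x) \<and>
     (\<forall>x. N x = 0 \<longleftrightarrow> x = 0) \<and>
     (\<forall>c x. N (c *\<^sub>R x) = \<bar>c\<bar> * N x) \<and>
     (\<forall>x y. N (x + y) \<le> N x + N y)"

definition strictly_convex :: "('a::real_vector \<Rightarrow> real) \<Rightarrow> bool" where
  "strictly_convex g \<longleftrightarrow>
     (\<forall>x y. x \<noteq> y \<longrightarrow> (\<forall>l. 0 < l \<and> l < 1 \<longrightarrow>
        g (l *\<^sub>R x + (1 - l) *\<^sub>R y) < l * g x + (1 - l) * g y))"

end

theory Submission
  imports Defs
begin

text \<open>Write \<open>N = f\<^bsup>1/d\<^esup>\<close>, so that \<open>f = N\<^bsup>d\<^esup>\<close> wherever \<open>f\<close> is nonnegative.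

  If \<open>f\<close> is strictly convex, then \<open>f 0 = 0\<close> is less than the mean of \<open>f x\<close> and \<open>f (-x)\<close>, which is
  \<open>f x\<close> because \<open>d\<close> is even; hence \<open>f\<close> is positive off the origin. The unit ball \<open>{f \<le> 1}\<close> of \<open>N\<close> is
  convex, and for a positively homogeneous function this is the triangle inequality.

  If \<open>N\<close> is a norm, then \<open>f = N\<^bsup>d\<^esup>\<close> is convex, because a power is convex and increasing on
  \<open>[0,\<infinity>)\<close>. The issue is strictness, which may fail for the powers of a general norm; here it comes
  from \<open>f\<close> being a polynomial. If the convexity inequality were an equality somewhere inside a
  segment, then \<open>f\<close> would be affine on a nondegenerate part of that segment, hence, being polynomial,
  affine on the whole line (\<open>eval_mpoly_affine_on_line\<close>). A nonnegative affine function on the real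
  line is constant, so \<open>N\<close> would be bounded on a line, which no norm is.\<close>

section \<open>Forms restricted to rays and lines\<close>

lemma eval_mpoly_scaleR:
  assumes "is_form d f"
  shows "eval_mpoly f (c *\<^sub>R x) = c ^ d * eval_mpoly f x"
proof -
  have "(\<Prod>i\<in>UNIV. ((c *\<^sub>R x) $ i) ^ Poly_Mapping.lookup m i)
          = c ^ d * (\<Prod>i\<in>UNIV. (x $ i) ^ Poly_Mapping.lookup m i)"
    if "m \<in> Poly_Mapping.keys f" for m
  proof -
    have "(\<Sum>i\<in>UNIV. Poly_Mapping.lookup m i) = d"
      using assms that by (simp add: is_form_def monomial_degree_def)
    then have "(\<Prod>i\<in>UNIV. c ^ Poly_Mapping.lookup m i) = c ^ d"
      by (simp flip: power_sum)
    then show ?thesis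
      by (simp add: power_mult_distrib prod.distrib)
  qed
  then show ?thesis
    by (simp add: eval_mpoly_def sum_distrib_left mult.left_commute)
qed

lemma eval_mpoly_poly_on_line:
  "\<exists>p. \<forall>t. eval_mpoly f (t *\<^sub>R x + (1 - t) *\<^sub>R y) = poly p t"
proof -
  define p where "p = (\<Sum>m\<in>Poly_Mapping.keys f. smult (Poly_Mapping.lookup f m)
    (\<Prod>i\<in>UNIV. [:y $ i, x $ i - y $ i:] ^ Poly_Mapping.lookup m i))"
  have "eval_mpoly f (t *\<^sub>R x + (1 - t) *\<^sub>R y) = poly p t" for t
    by (simp add: eval_mpoly_def p_def poly_sum poly_prod algebra_simps)
  then show ?thesis by blast
qed

text \<open>Two polynomials in one variable that agree on an interval are equal.\<close>
lemma eval_mpoly_affine_on_line: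
  assumes "a < b"
    and affine: "\<And>t. a < t \<Longrightarrow> t < b \<Longrightarrow>
      eval_mpoly f (t *\<^sub>R x + (1 - t) *\<^sub>R y) = t * u + (1 - t) * v"
  shows "eval_mpoly f (t *\<^sub>R x + (1 - t) *\<^sub>R y) = t * u + (1 - t) * v"
proof -
  obtain p where p: "\<And>t. eval_mpoly f (t *\<^sub>R x + (1 - t) *\<^sub>R y) = poly p t"
    using eval_mpoly_poly_on_line by metis
  define q where "q = p - [:v, u - v:]"
  have q: "poly q t = eval_mpoly f (t *\<^sub>R x + (1 - t) *\<^sub>R y) - (t * u + (1 - t) * v)" for t
    by (simp add: q_def p) (simp add: algebra_simps)
  have "{a<..<b} \<subseteq> {t. poly q t = 0}"
    using affine by (auto simp: q)
  then have "infinite {t. poly q t = 0}"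
    using infinite_Ioo[OF \<open>a < b\<close>] finite_subset by blast
  then have "q = 0"
    using poly_roots_finite by blast
  then show ?thesis
    using q[of t] by simp
qed

section \<open>Convexity\<close>

text \<open>If a convex function meets its chord at the inner point \<open>l\<close>, it meets it at every \<open>t\<close> beyond
  \<open>l\<close> as well: a value below the chord at \<open>t\<close> would, by convexity between \<open>0\<close> and \<open>t\<close>, pull the value
  at \<open>l\<close> below the chord.\<close>
lemma convex_on_meets_chord:
  fixes g :: "'a::real_vector \<Rightarrow> real"
  assumes g: "convex_on UNIV g" and "0 < l" "l < t" "t < 1"
    and meets: "l * g x + (1 - l) * g y \<le> g (l *\<^sub>R x + (1 - l) *\<^sub>R y)"
  shows "g (t *\<^sub>R x + (1 - t) *\<^sub>R y) = t * g x + (1 - t) * g y"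
proof (rule antisym)
  show "g (t *\<^sub>R x + (1 - t) *\<^sub>R y) \<le> t * g x + (1 - t) * g y"
    using convex_onD[OF g, of "1 - t" x y] assms by simp
next
  define z where "z = t *\<^sub>R x + (1 - t) *\<^sub>R y"
  define s where "s = l / t"
  have s: "0 < s" "s < 1" "s * t = l"
    using assms by (auto simp: s_def)
  have "s *\<^sub>R z + (1 - s) *\<^sub>R y = (s * t) *\<^sub>R x + (1 - s * t) *\<^sub>R y"
    by (simp add: z_def algebra_simps)
  then have "g (l *\<^sub>R x + (1 - l) *\<^sub>R y) \<le> s * g z + (1 - s) * g y"
    using convex_onD[OF g, of "1 - s" z y] s by simp
  with meets have "s * t * g x + (1 - s * t) * g y \<le> s * g z + (1 - s) * g y"
    by (simp add: s)
  then have "s * (t * g x + (1 - t) * g y) \<le> s * g z"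
    by (simp add: algebra_simps)
  then show "t * g x + (1 - t) * g y \<le> g (t *\<^sub>R x + (1 - t) *\<^sub>R y)"
    using s by (simp add: z_def)
qed

lemma is_norm_power_convex:
  assumes "is_norm N"
  shows "convex_on UNIV (\<lambda>x. N x ^ d)"
proof (rule convex_onI)
  fix l x y assume l: "0 < l" "l < (1::real)"
  have nonneg: "0 \<le> N z" and scale: "N (c *\<^sub>R z) = \<bar>c\<bar> * N z"
    and tri: "N (z + w) \<le> N z + N w" for c z w
    using assms unfolding is_norm_def by blast+
  have "N ((1 - l) *\<^sub>R x + l *\<^sub>R y) \<le> (1 - l) * N x + l * N y"
    using tri[of "(1 - l) *\<^sub>R x" "l *\<^sub>R y"] l by (simp add: scale)
  then have "N ((1 - l) *\<^sub>R x + l *\<^sub>R y) ^ d \<le> ((1 - l) * N x + l * N y) ^ d"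
    by (intro power_mono nonneg)
  also have "((1 - l) * N x + l * N y) ^ d \<le> (1 - l) * N x ^ d + l * N y ^ d"
  proof -
    have "convex_on {0..} (\<lambda>u::real. u ^ d)"
      using convex_power_odd convex_on_subset[OF convex_power_even] by (cases "even d") auto
    then show ?thesis
      using convex_onD[of "{0..}" "\<lambda>u. u ^ d" l "N x" "N y"] l nonneg by simp
  qed
  finally show "N ((1 - l) *\<^sub>R x + l *\<^sub>R y) ^ d \<le> (1 - l) * N x ^ d + l * N y ^ d" .
qed simp

section \<open>From a norm to strict convexity\<close>

text \<open>By the triangle inequality a norm is at least \<open>\<bar>t\<bar> * N (x - y) - N y\<close> at parameter \<open>t\<close>, hence
  unbounded on the line.\<close>
lemma is_norm_not_constant_on_line:
  assumes "is_norm N" and "x \<noteq> y"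
  shows "\<not> (\<forall>t. N (t *\<^sub>R x + (1 - t) *\<^sub>R y) = C)"
proof
  assume const: "\<forall>t. N (t *\<^sub>R x + (1 - t) *\<^sub>R y) = C"
  have scale: "N (c *\<^sub>R z) = \<bar>c\<bar> * N z" and tri: "N (z + w) \<le> N z + N w"
    and nonneg: "0 \<le> N z" and zero: "N z = 0 \<longleftrightarrow> z = 0" for c z w
    using assms(1) unfolding is_norm_def by blast+
  have "N (x - y) > 0"
    using zero[of "x - y"] nonneg[of "x - y"] assms(2) by simp
  have bound: "\<bar>t\<bar> * N (x - y) \<le> 2 * C" for t
  proof -
    have "t *\<^sub>R (x - y) = (t *\<^sub>R x + (1 - t) *\<^sub>R y) + (-1) *\<^sub>R y"
      by (simp add: algebra_simps)
    then have "N (t *\<^sub>R (x - y)) \<le> N (t *\<^sub>R x + (1 - t) *\<^sub>R y) + N ((-1) *\<^sub>R y)"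
      using tri by metis
    moreover have "N y = C"
      using const[rule_format, of 0] by simp
    ultimately show ?thesis
      using const by (simp only: scale)
  qed
  have "\<bar>(2 * C + 1) / N (x - y)\<bar> * N (x - y) \<ge> 2 * C + 1"
    using \<open>N (x - y) > 0\<close> by (simp add: abs_divide)
  with bound[of "(2 * C + 1) / N (x - y)"] show False by linarith
qed

lemma nonneg_affine_constant:
  fixes u v :: real
  assumes "\<And>t. 0 \<le> t * u + (1 - t) * v"
  shows "u = v"
proof (rule ccontr)
  assume "u \<noteq> v"
  \<comment> \<open>at this parameter the affine function takes the value \<open>-1\<close>\<close>
  define t where "t = - (v + 1) / (u - v)"
  have "t * (u - v) = - (v + 1)"
    using \<open>u \<noteq> v\<close> by (simp add: t_def)
  with assms[of t] show False
    by (simp add: algebra_simps)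
qed

lemma strictly_convex_of_norm_root:
  assumes "0 < d" and nonneg: "\<And>x. 0 \<le> eval_mpoly f x"
    and norm: "is_norm (\<lambda>x. root d (eval_mpoly f x))"
  shows "strictly_convex (eval_mpoly f)"
  unfolding strictly_convex_def
proof (intro allI impI)
  fix x y :: "real ^ 'a" and l :: real
  assume "x \<noteq> y" and l: "0 < l \<and> l < 1"
  have convex: "convex_on UNIV (eval_mpoly f)"
    using is_norm_power_convex[OF norm, of d] nonneg \<open>0 < d\<close> by simp
  show "eval_mpoly f (l *\<^sub>R x + (1 - l) *\<^sub>R y) < l * eval_mpoly f x + (1 - l) * eval_mpoly f y"
  proof (rule ccontr)
    assume "\<not> ?thesis"
    then have "eval_mpoly f (t *\<^sub>R x + (1 - t) *\<^sub>R y) = t * eval_mpoly f x + (1 - t) * eval_mpoly f y"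
      if "l < t" "t < 1" for t
      using convex_on_meets_chord[OF convex] that l by simp
    then have affine:
      "eval_mpoly f (t *\<^sub>R x + (1 - t) *\<^sub>R y) = t * eval_mpoly f x + (1 - t) * eval_mpoly f y" for t
      using eval_mpoly_affine_on_line[of l 1 f x y] l by blast
    then have "eval_mpoly f x = eval_mpoly f y"
      by (metis nonneg nonneg_affine_constant)
    with affine have "eval_mpoly f (t *\<^sub>R x + (1 - t) *\<^sub>R y) = eval_mpoly f y" for t
      by (simp add: algebra_simps)
    then show False
      using is_norm_not_constant_on_line[OF norm \<open>x \<noteq> y\<close>, of "root d (eval_mpoly f y)"] by simp
  qed
qed

section \<open>From strict convexity to a norm\<close>

text \<open>Rescale \<open>x\<close> and \<open>y\<close> to unit vectors. Then \<open>(x + y) / (N x + N y)\<close> is a convex combination of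
  them with weights proportional to \<open>N x\<close> and \<open>N y\<close>, so it stays in the convex unit ball.\<close>
lemma root_triangle_of_convex:
  fixes g :: "'a::real_vector \<Rightarrow> real"
  assumes "0 < d" and convex: "convex_on UNIV g"
    and hom: "\<And>c x. g (c *\<^sub>R x) = c ^ d * g x"
    and pos: "0 < g x" "0 < g y"
  shows "root d (g (x + y)) \<le> root d (g x) + root d (g y)"
proof -
  define a b where "a = root d (g x)" and "b = root d (g y)"
  have ab: "0 < a" "0 < b" "a ^ d = g x" "b ^ d = g y"
    using pos \<open>0 < d\<close> by (auto simp: a_def b_def)
  have unit: "g ((1 / a) *\<^sub>R x) = 1" "g ((1 / b) *\<^sub>R y) = 1"
    using ab pos by (auto simp: hom power_divide)
  define l where "l = b / (a + b)"
  have l: "0 \<le> l" "l \<le> 1" "1 - l = a / (a + b)"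
    using ab by (auto simp: l_def field_simps)
  have "(1 - l) *\<^sub>R ((1 / a) *\<^sub>R x) + l *\<^sub>R ((1 / b) *\<^sub>R y) = (1 / (a + b)) *\<^sub>R (x + y)"
    using ab unfolding l(3) by (simp add: l_def scaleR_add_right)
  then have "g ((1 / (a + b)) *\<^sub>R (x + y)) \<le> 1"
    using convex_onD[OF convex l(1,2), of "(1 / a) *\<^sub>R x" "(1 / b) *\<^sub>R y"] unit by simp
  then have "g (x + y) \<le> (a + b) ^ d"
    using ab by (simp add: hom power_divide)
  then have "root d (g (x + y)) \<le> root d ((a + b) ^ d)"
    using \<open>0 < d\<close> by simp
  then show ?thesis
    using ab \<open>0 < d\<close> by (simp add: real_root_power_cancel flip: a_def b_def)
qed

lemma strictly_convex_imp_convex_on: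
  assumes "strictly_convex g"
  shows "convex_on UNIV g"
proof (rule convex_onI)
  fix l x y assume l: "0 < l" "l < (1::real)"
  show "g ((1 - l) *\<^sub>R x + l *\<^sub>R y) \<le> (1 - l) * g x + l * g y"
  proof (cases "x = y")
    case True
    then show ?thesis
      by (simp add: algebra_simps flip: scaleR_add_left)
  next
    case False
    then have "g ((1 - l) *\<^sub>R x + (1 - (1 - l)) *\<^sub>R y) < (1 - l) * g x + (1 - (1 - l)) * g y"
      using assms l unfolding strictly_convex_def by (metis diff_gt_0_iff_gt diff_less_eq less_add_same_cancel1)
    then show ?thesis by simp
  qed
qed simp

lemma strictly_convex_even_pos:
  assumes "strictly_convex g" and "g 0 = 0" and "g (- x) = g x" and "x \<noteq> 0"
  shows "0 < g x"
proof -
  have "x \<noteq> - x"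
    using \<open>x \<noteq> 0\<close> by (metis add.right_inverse scaleR_2 scaleR_eq_0_iff zero_neq_numeral)
  then have "g ((1/2) *\<^sub>R x + (1 - 1/2) *\<^sub>R (- x)) < 1/2 * g x + (1 - 1/2) * g (- x)"
    using assms(1)[unfolded strictly_convex_def, rule_format, of x "- x" "1/2"] by simp
  then show ?thesis
    using assms by simp
qed

lemma norm_root_of_strictly_convex:
  fixes g :: "'a::real_vector \<Rightarrow> real"
  assumes "even d" "0 < d" and strict: "strictly_convex g"
    and hom: "\<And>c x. g (c *\<^sub>R x) = c ^ d * g x"
  shows "(\<forall>x. 0 \<le> g x) \<and> is_norm (\<lambda>x. root d (g x))"
proof -
  have g0: "g 0 = 0"
    using hom[of 0 0] \<open>0 < d\<close> by (simp add: power_0_left)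
  have "g (- x) = g x" for x
    using hom[of "-1" x] \<open>even d\<close> by simp
  then have pos: "0 < g x" if "x \<noteq> 0" for x
    using strictly_convex_even_pos[OF strict g0] that by blast
  then have nonneg: "0 \<le> g x" for x
    using g0 by (cases "x = 0") (auto intro: less_imp_le)
  have zero: "g x = 0 \<longleftrightarrow> x = 0" for x
    using pos[of x] g0 by (cases "x = 0") auto
  have scale: "root d (g (c *\<^sub>R x)) = \<bar>c\<bar> * root d (g x)" for c x
  proof -
    have "root d (c ^ d) = root d (\<bar>c\<bar> ^ d)"
      using \<open>even d\<close> by (simp add: power_even_abs)
    then show ?thesis
      using \<open>0 < d\<close> by (simp add: hom real_root_mult real_root_power_cancel)
  qed
  have tri: "root d (g (x + y)) \<le> root d (g x) + root d (g y)" for x y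
  proof (cases "x = 0 \<or> y = 0")
    case True
    then show ?thesis
      using g0 by auto
  next
    case False
    then show ?thesis
      using root_triangle_of_convex[OF \<open>0 < d\<close> strictly_convex_imp_convex_on[OF strict] hom]
        pos by blast
  qed
  show ?thesis
    using nonneg zero scale tri \<open>0 < d\<close> by (simp add: is_norm_def)
qed

theorem theorem6p2p2:
  fixes d :: nat and f :: "'n::finite mpoly_real"
  assumes "even d" and "0 < d" and "is_form d f"
  shows "((\<forall>x. 0 \<le> eval_mpoly f x) \<and> is_norm (\<lambda>x. root d (eval_mpoly f x)))
           \<longleftrightarrow> strictly_convex (eval_mpoly f)"
  using strictly_convex_of_norm_root[OF \<open>0 < d\<close>]
    norm_root_of_strictly_convex[OF \<open>even d\<close> \<open>0 < d\<close> _ eval_mpoly_scaleR[OF \<open>is_form d f\<close>]]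
  by blast

end
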